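(* Let $x_i\in\mathbb{R}^m$ and $y_i\in\{-1,1\}$ for $i\in I=\{1,\dots,n\}$, let $M>0$, and let $C^t=\{C_k^t\}_{k\in K^t}$ be a partition of $I$ into nonempty clusters such that all entries in a cluster have the same label. Let $(\bar w^t,\bar b^t,\bar\xi^t)$ be an optimal solution of the aggregated SVM problem $$F^t=\min_{w,b,\xi}\ \tfrac12\|w\|^2+M\sum_{k\in K^t}|C_k^t|\xi_k\quad\text{s.t. } y_k^t(w x_k^t+b)\ge1-\xi_k,\ \xi_k\ge0,\ k\in K^t .$$ Suppose that for all $k\in K^t$, either (i) $1-y_i(\bar w^tx_i+\bar b^t)\le0$ for all $i\in C_k^t$, or (ii) $1-y_i(\bar w^tx_i+\bar b^t)>0$ for all $i\in C_k^t$. Then $(\hat w^t,\hat b^t,\hat\xi^t)$, defined by $\hat w^t=\bar w^t$, $\hat b^t=\bar b^t$, $\hat\xi_i^t=\max\{0,1-y_i(\bar w^tx_i+\bar b^t)\}$ for $i\in I$, is an optimal solution of the original SVM problem $$E^*=\min_{w,b,\xi}\ \tfrac12\|w\|^2+M\|\xi\|_1\quad\text{s.t. } y_i(wx_i+b)\ge1-\xi_i,\ \xi_i\ge0,\ i\in I .$$ Further, $E^t=F^t$, where $E^t=\tfrac12\|\hat w^t\|^2+M\|\hat\xi^t\|_1$.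
   Context: Here $w\in\mathbb{R}^m$, $b\in\mathbb{R}$, $wx_i$ denotes the Euclidean inner product, $\|\cdot\|$ the Euclidean norm, and $\xi\in\mathbb{R}_+^n$ (original problem) or $\xi\in\mathbb{R}_+^{|K^t|}$ (aggregated problem). The aggregated data are $x_k^t=\frac{1}{|C_k^t|}\sum_{i\in C_k^t}x_i$ and $y_k^t=\frac{1}{|C_k^t|}\sum_{i\in C_k^t}y_i\in\{-1,1\}$, so $y_k^t=y_i$ for all $i\in C_k^t$. *)

theory Defs
  imports "HOL-Analysis.Analysis"
begin

(* A vector indexed by a finite set A (slacks, data, labels) is a function of which only the
   values on A matter: constraints and objectives below never inspect it outside A. *)

definition svm_feasible ::
    "'i set \<Rightarrow> ('i \<Rightarrow> real ^ 'm) \<Rightarrow> ('i \<Rightarrow> real) \<Rightarrow> (real ^ 'm) \<times> real \<times> ('i \<Rightarrow> real) \<Rightarrow> bool" where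
  "svm_feasible A x y = (\<lambda>(w, b, \<xi>).
     \<forall>i\<in>A. y i * (w \<bullet> x i + b) \<ge> 1 - \<xi> i \<and> \<xi> i \<ge> 0)"

definition l1_norm_on :: "'i set \<Rightarrow> ('i \<Rightarrow> real) \<Rightarrow> real" where
  "l1_norm_on A \<xi> = (\<Sum>i\<in>A. \<bar>\<xi> i\<bar>)"

definition svm_objective ::
    "real \<Rightarrow> 'i set \<Rightarrow> (real ^ 'm) \<times> real \<times> ('i \<Rightarrow> real) \<Rightarrow> real" where
  "svm_objective M I = (\<lambda>(w, b, \<xi>). 1 / 2 * (norm w)\<^sup>2 + M * l1_norm_on I \<xi>)"

definition svm_optimal ::
    "real \<Rightarrow> 'i set \<Rightarrow> ('i \<Rightarrow> real ^ 'm) \<Rightarrow> ('i \<Rightarrow> real) \<Rightarrow> (real ^ 'm) \<times> real \<times> ('i \<Rightarrow> real) \<Rightarrow> bool" where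
  "svm_optimal M I x y = is_arg_min (svm_objective M I) (svm_feasible I x y)"

definition cluster_mean :: "('k \<Rightarrow> 'i set) \<Rightarrow> ('i \<Rightarrow> 'a::real_vector) \<Rightarrow> 'k \<Rightarrow> 'a" where
  "cluster_mean C f k = (1 / real (card (C k))) *\<^sub>R (\<Sum>i\<in>C k. f i)"

definition agg_svm_feasible ::
    "'k set \<Rightarrow> ('k \<Rightarrow> 'i set) \<Rightarrow> ('i \<Rightarrow> real ^ 'm) \<Rightarrow> ('i \<Rightarrow> real) \<Rightarrow>
      (real ^ 'm) \<times> real \<times> ('k \<Rightarrow> real) \<Rightarrow> bool" where
  "agg_svm_feasible K C x y = svm_feasible K (cluster_mean C x) (cluster_mean C y)"

definition agg_svm_objective ::
    "real \<Rightarrow> 'k set \<Rightarrow> ('k \<Rightarrow> 'i set) \<Rightarrow> (real ^ 'm) \<times> real \<times> ('k \<Rightarrow> real) \<Rightarrow> real" where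
  "agg_svm_objective M K C =
     (\<lambda>(w, b, \<xi>). 1 / 2 * (norm w)\<^sup>2 + M * (\<Sum>k\<in>K. real (card (C k)) * \<xi> k))"

definition agg_svm_optimal ::
    "real \<Rightarrow> 'k set \<Rightarrow> ('k \<Rightarrow> 'i set) \<Rightarrow> ('i \<Rightarrow> real ^ 'm) \<Rightarrow> ('i \<Rightarrow> real) \<Rightarrow>
      (real ^ 'm) \<times> real \<times> ('k \<Rightarrow> real) \<Rightarrow> bool" where
  "agg_svm_optimal M K C x y = is_arg_min (agg_svm_objective M K C) (agg_svm_feasible K C x y)"

(* The infimum is over a set of nonnegative reals; it is the minimum whenever an optimal
   solution exists. *)
definition agg_svm_value ::
    "real \<Rightarrow> 'k set \<Rightarrow> ('k \<Rightarrow> 'i set) \<Rightarrow> ('i \<Rightarrow> real ^ 'm) \<Rightarrow> ('i \<Rightarrow> real) \<Rightarrow> real" where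
  "agg_svm_value M K C x y = Inf (agg_svm_objective M K C ` Collect (agg_svm_feasible K C x y))"

(* Injectivity on K prevents one cluster from being listed under two indices; distinct indices
   then have disjoint nonempty clusters, so K is finite when I is. *)
definition indexed_partition :: "'i set \<Rightarrow> 'k set \<Rightarrow> ('k \<Rightarrow> 'i set) \<Rightarrow> bool" where
  "indexed_partition I K C \<longleftrightarrow> inj_on C K \<and> partition_on I (C ` K)"

end

theory Submission
  imports Defs
begin

text \<open>
  Averaging the slacks over each cluster maps feasible points of the original problem to feasible
  points of the aggregated one with the same objective value, so the aggregated optimum is a lower
  bound for the original one. On a cluster whose residuals
  \<open>1 - y\<^sub>i (w x\<^sub>i + b)\<close> all have the same sign, the positive part commutes with summation, so
  the hinge losses of the cluster add up to at most its size times the aggregated slack. Hence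
  the disaggregated point attains the lower bound.
\<close>

text \<open>These facts allow sums over \<open>I\<close> to be regrouped cluster by cluster and each
  cluster size to be cancelled as a positive number.\<close>

lemma
  assumes "indexed_partition I K C" "finite I"
  shows indexed_partition_UN: "(\<Union>k\<in>K. C k) = I"
    and indexed_partition_finite: "\<And>k. k \<in> K \<Longrightarrow> finite (C k)"
    and indexed_partition_nonempty: "\<And>k. k \<in> K \<Longrightarrow> C k \<noteq> {}"
    and sum_indexed_partition: "\<And>f :: 'i \<Rightarrow> real. sum f I = (\<Sum>k\<in>K. \<Sum>i\<in>C k. f i)"
proof -
  have inj: "inj_on C K" and part: "partition_on I (C ` K)"
    using assms(1) by (auto simp: indexed_partition_def)
  show UN: "(\<Union>k\<in>K. C k) = I"
    using partition_onD1[OF part] by simp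
  have fin_K: "finite K"
    using finite_elements[OF assms(2) part] inj by (rule finite_imageD)
  show fin_C: "finite (C k)" if "k \<in> K" for k
    using UN that assms(2) by (metis UN_upper finite_subset)
  show "C k \<noteq> {}" if "k \<in> K" for k
    using partition_onD3[OF part] that by (metis imageI)
  have "C k \<inter> C l = {}" if "k \<in> K" "l \<in> K" "k \<noteq> l" for k l
    using partition_onD2[OF part] inj that by (metis disjointD imageI inj_onD)
  then show "sum f I = (\<Sum>k\<in>K. \<Sum>i\<in>C k. f i)" for f :: "'i \<Rightarrow> real"
    using sum.UNION_disjoint[of K C f] fin_K fin_C UN by auto
qed

lemma card_mult_cluster_mean:
  fixes f :: "'i \<Rightarrow> real"
  assumes "finite (C k)" "C k \<noteq> {}"
  shows "real (card (C k)) * cluster_mean C f k = (\<Sum>i\<in>C k. f i)"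
  using assms by (simp add: cluster_mean_def)

text \<open>Applied to \<open>y\<close>, this identifies the aggregated label with the common label
  of the cluster.\<close>

lemma cluster_mean_const:
  fixes f :: "'i \<Rightarrow> real"
  assumes "finite (C k)" "i \<in> C k" "\<And>j. j \<in> C k \<Longrightarrow> f j = f i"
  shows "cluster_mean C f k = f i"
proof -
  have "(\<Sum>j\<in>C k. f j) = real (card (C k)) * f i"
    using assms(3) by simp
  then show ?thesis
    using assms(1,2) by (auto simp: cluster_mean_def)
qed

text \<open>Once the label is constant on the cluster, the residual is an affine function of the
  data point, and affine functions commute with averaging. Scaling by the cluster size keeps the
  identity free of division.\<close>

lemma card_mult_aggregated_residual:
  fixes x :: "'i \<Rightarrow> real ^ 'm" and y :: "'i \<Rightarrow> real"
  assumes "finite (C k)" "C k \<noteq> {}" "\<And>i j. i \<in> C k \<Longrightarrow> j \<in> C k \<Longrightarrow> y i = y j"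
  shows "real (card (C k)) * (1 - cluster_mean C y k * (w \<bullet> cluster_mean C x k + b)) =
    (\<Sum>i\<in>C k. 1 - y i * (w \<bullet> x i + b))"
proof -
  obtain i where i: "i \<in> C k"
    using assms(2) by blast
  \<comment> \<open>Linearity of the inner product turns a mean of vectors into a mean of reals, to
    which \<open>card_mult_cluster_mean\<close> applies.\<close>
  have mean: "w \<bullet> cluster_mean C x k = cluster_mean C (\<lambda>i. w \<bullet> x i) k"
    by (simp add: cluster_mean_def inner_sum_right)
  have label: "cluster_mean C y k = y i"
    using assms(1) i assms(3)[OF _ i] by (rule cluster_mean_const)
  have "(\<Sum>j\<in>C k. 1 - y j * (w \<bullet> x j + b)) = (\<Sum>j\<in>C k. 1 - y i * (w \<bullet> x j + b))"
    using assms(3)[OF _ i] by simp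
  also have "\<dots> = real (card (C k)) - y i * ((\<Sum>j\<in>C k. w \<bullet> x j) + real (card (C k)) * b)"
    by (simp add: sum_subtractf sum_distrib_left[symmetric] sum.distrib)
  also have "\<dots> = real (card (C k)) * (1 - y i * (cluster_mean C (\<lambda>i. w \<bullet> x i) k + b))"
    unfolding card_mult_cluster_mean[of C k, OF assms(1,2), symmetric] by (simp add: algebra_simps)
  finally show ?thesis
    by (simp add: mean label)
qed

text \<open>Adding up the constraints of one cluster gives its aggregated constraint, scaled by the
  cluster size. The same size is the weight in the aggregated objective, so it undoes the averaging
  of the slacks.\<close>

lemma aggregate_feasible:
  fixes x :: "'i \<Rightarrow> real ^ 'm" and y \<xi> :: "'i \<Rightarrow> real"
  assumes part: "indexed_partition I K C" and fin: "finite I"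
    and same_label: "\<forall>k\<in>K. \<forall>i\<in>C k. \<forall>j\<in>C k. y i = y j"
    and feas: "svm_feasible I x y (w, b, \<xi>)"
  shows "agg_svm_feasible K C x y (w, b, cluster_mean C \<xi>)"
    and "agg_svm_objective M K C (w, b, cluster_mean C \<xi>) = svm_objective M I (w, b, \<xi>)"
proof -
  note finC = indexed_partition_finite[OF part fin] and neC = indexed_partition_nonempty[OF part fin]
  have slack: "1 - y i * (w \<bullet> x i + b) \<le> \<xi> i" "0 \<le> \<xi> i" if "i \<in> I" for i
    using feas that by (auto simp: svm_feasible_def algebra_simps)
  have mem: "i \<in> I" if "k \<in> K" "i \<in> C k" for k i
    using indexed_partition_UN[OF part fin] that by blast
  show "agg_svm_feasible K C x y (w, b, cluster_mean C \<xi>)"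
    unfolding agg_svm_feasible_def svm_feasible_def prod.case
  proof (intro ballI conjI)
    fix k assume k: "k \<in> K"
    have pos: "real (card (C k)) > 0"
      using finC[OF k] neC[OF k] by (simp add: card_gt_0_iff)
    have "real (card (C k)) * (1 - cluster_mean C y k * (w \<bullet> cluster_mean C x k + b)) =
        (\<Sum>i\<in>C k. 1 - y i * (w \<bullet> x i + b))"
      using finC[OF k] neC[OF k] same_label k by (intro card_mult_aggregated_residual) blast+
    also have "\<dots> \<le> (\<Sum>i\<in>C k. \<xi> i)"
      using mem[OF k] slack by (intro sum_mono) auto
    also have "\<dots> = real (card (C k)) * cluster_mean C \<xi> k"
      using finC[OF k] neC[OF k] by (simp add: card_mult_cluster_mean)
    finally have "1 - cluster_mean C y k * (w \<bullet> cluster_mean C x k + b) \<le> cluster_mean C \<xi> k"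
      using pos by (simp only: mult_le_cancel_left_pos)
    then show "1 - cluster_mean C \<xi> k \<le> cluster_mean C y k * (w \<bullet> cluster_mean C x k + b)"
      by simp
    show "0 \<le> cluster_mean C \<xi> k"
      unfolding cluster_mean_def using mem[OF k] slack(2) by (auto intro!: sum_nonneg divide_nonneg_nonneg)
  qed
  have "(\<Sum>k\<in>K. real (card (C k)) * cluster_mean C \<xi> k) = (\<Sum>k\<in>K. \<Sum>i\<in>C k. \<xi> i)"
    using finC neC by (intro sum.cong) (auto simp: card_mult_cluster_mean)
  \<comment> \<open>Feasible slacks are nonnegative, so the absolute values in the norm
    disappear.\<close>
  also have "\<dots> = l1_norm_on I \<xi>"
    using slack(2) by (simp add: l1_norm_on_def sum_indexed_partition[OF part fin, symmetric])
  finally show "agg_svm_objective M K C (w, b, cluster_mean C \<xi>) = svm_objective M I (w, b, \<xi>)"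
    by (simp add: agg_svm_objective_def svm_objective_def)
qed

text \<open>The positive part is additive on each of the two half-lines, being zero on one and the
  identity on the other. Mixed signs would only give subadditivity.\<close>

lemma sum_positive_part_same_sign:
  fixes r :: "'i \<Rightarrow> real"
  assumes "(\<forall>i\<in>A. r i \<le> 0) \<or> (\<forall>i\<in>A. r i > 0)"
  shows "(\<Sum>i\<in>A. max 0 (r i)) = max 0 (\<Sum>i\<in>A. r i)"
  using assms
proof
  assume "\<forall>i\<in>A. r i \<le> 0"
  then show ?thesis
    by (simp add: max_absorb1 sum_nonpos)
next
  assume "\<forall>i\<in>A. r i > 0"
  then have "\<forall>i\<in>A. r i \<ge> 0"
    by (simp add: less_imp_le)
  then show ?thesis
    by (simp add: max_absorb2 sum_nonneg)
qed

text \<open>This is the upper bound, valid for any aggregated feasible point whose clusters satisfy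
  the sign condition, optimal or not. The sign condition moves the positive part outside the cluster
  sum, where \<open>\<eta> k\<close> controls it.\<close>

lemma hinge_objective_le:
  fixes x :: "'i \<Rightarrow> real ^ 'm" and y \<xi> :: "'i \<Rightarrow> real"
  assumes part: "indexed_partition I K C" and fin: "finite I" and "M \<ge> 0"
    and same_label: "\<forall>k\<in>K. \<forall>i\<in>C k. \<forall>j\<in>C k. y i = y j"
    and feas: "agg_svm_feasible K C x y (w, b, \<eta>)"
    and clusters: "\<forall>k\<in>K. (\<forall>i\<in>C k. 1 - y i * (w \<bullet> x i + b) \<le> 0) \<or>
                          (\<forall>i\<in>C k. 1 - y i * (w \<bullet> x i + b) > 0)"
    and \<xi>: "\<forall>i\<in>I. \<xi> i = max 0 (1 - y i * (w \<bullet> x i + b))"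
  shows "svm_objective M I (w, b, \<xi>) \<le> agg_svm_objective M K C (w, b, \<eta>)"
proof -
  note finC = indexed_partition_finite[OF part fin] and neC = indexed_partition_nonempty[OF part fin]
  have "l1_norm_on I \<xi> = (\<Sum>i\<in>I. max 0 (1 - y i * (w \<bullet> x i + b)))"
    unfolding l1_norm_on_def using \<xi> by (intro sum.cong) auto
  also have "\<dots> = (\<Sum>k\<in>K. \<Sum>i\<in>C k. max 0 (1 - y i * (w \<bullet> x i + b)))"
    by (rule sum_indexed_partition[OF part fin])
  also have "\<dots> \<le> (\<Sum>k\<in>K. real (card (C k)) * \<eta> k)"
  proof (rule sum_mono)
    fix k assume k: "k \<in> K"
    have \<eta>: "1 - cluster_mean C y k * (w \<bullet> cluster_mean C x k + b) \<le> \<eta> k" "0 \<le> \<eta> k"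
      using feas k by (auto simp: agg_svm_feasible_def svm_feasible_def algebra_simps)
    have "(\<Sum>i\<in>C k. max 0 (1 - y i * (w \<bullet> x i + b))) = max 0 (\<Sum>i\<in>C k. 1 - y i * (w \<bullet> x i + b))"
      using clusters k by (intro sum_positive_part_same_sign) blast
    also have "(\<Sum>i\<in>C k. 1 - y i * (w \<bullet> x i + b)) =
        real (card (C k)) * (1 - cluster_mean C y k * (w \<bullet> cluster_mean C x k + b))"
      using finC[OF k] neC[OF k] same_label k by (intro card_mult_aggregated_residual[symmetric]) blast+
    \<comment> \<open>Aggregated feasibility makes \<open>\<eta> k\<close> dominate both 0 and the
      aggregated residual, and multiplying by the cluster size preserves this.\<close>
    also have "max 0 \<dots> \<le> real (card (C k)) * \<eta> k"
      using \<eta> by (intro max.boundedI mult_left_mono mult_nonneg_nonneg) auto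
    finally show "(\<Sum>i\<in>C k. max 0 (1 - y i * (w \<bullet> x i + b))) \<le> real (card (C k)) * \<eta> k" .
  qed
  finally show ?thesis
    using \<open>M \<ge> 0\<close> by (simp add: svm_objective_def agg_svm_objective_def mult_left_mono)
qed

text \<open>An optimal point attains the infimum, so the claim about the value reduces to comparing
  two objective values.\<close>

lemma agg_svm_value_eq:
  assumes "agg_svm_optimal M K C x y p"
  shows "agg_svm_value M K C x y = agg_svm_objective M K C p"
  unfolding agg_svm_value_def
  using assms by (intro cInf_eq_minimum) (auto simp: agg_svm_optimal_def is_arg_min_linorder)

theorem proposition3:
  fixes n :: nat and M :: real
    and x :: "nat \<Rightarrow> real ^ 'm" and y :: "nat \<Rightarrow> real"
    and K :: "'k set" and C :: "'k \<Rightarrow> nat set"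
    and w_bar w_hat :: "real ^ 'm" and b_bar b_hat :: real
    and \<xi>_bar :: "'k \<Rightarrow> real" and \<xi>_hat :: "nat \<Rightarrow> real"
  assumes labels: "\<forall>i\<in>{1..n}. y i \<in> {-1, 1}"
    and M_pos: "M > 0"
    and part: "indexed_partition {1..n} K C"
    and same_label: "\<forall>k\<in>K. \<forall>i\<in>C k. \<forall>j\<in>C k. y i = y j"
    and bar_optimal: "agg_svm_optimal M K C x y (w_bar, b_bar, \<xi>_bar)"
    and clusters: "\<forall>k\<in>K. (\<forall>i\<in>C k. 1 - y i * (w_bar \<bullet> x i + b_bar) \<le> 0) \<or>
                          (\<forall>i\<in>C k. 1 - y i * (w_bar \<bullet> x i + b_bar) > 0)"
    and w_hat: "w_hat = w_bar"
    and b_hat: "b_hat = b_bar"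
    and \<xi>_hat: "\<forall>i\<in>{1..n}. \<xi>_hat i = max 0 (1 - y i * (w_bar \<bullet> x i + b_bar))"
  shows "svm_optimal M {1..n} x y (w_hat, b_hat, \<xi>_hat) \<and>
         svm_objective M {1..n} (w_hat, b_hat, \<xi>_hat) = agg_svm_value M K C x y"
proof -
  have bar_feasible: "agg_svm_feasible K C x y (w_bar, b_bar, \<xi>_bar)"
    using bar_optimal by (simp add: agg_svm_optimal_def is_arg_min_linorder)
  have bar_le: "agg_svm_objective M K C (w_bar, b_bar, \<xi>_bar) \<le> agg_svm_objective M K C p"
    if "agg_svm_feasible K C x y p" for p
    using bar_optimal that unfolding agg_svm_optimal_def is_arg_min_linorder by blast
  \<comment> \<open>The competitor to the aggregated optimum is \<open>p\<close> with its slacks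
    averaged over each cluster, which has the same objective value as \<open>p\<close>.\<close>
  have lower: "agg_svm_objective M K C (w_bar, b_bar, \<xi>_bar) \<le> svm_objective M {1..n} p"
    if "svm_feasible {1..n} x y p" for p
    using that aggregate_feasible[OF part finite_atLeastAtMost same_label, of x]
    by (cases p) (metis bar_le)
  have hat_feasible: "svm_feasible {1..n} x y (w_hat, b_hat, \<xi>_hat)"
    using w_hat b_hat \<xi>_hat by (auto simp: svm_feasible_def)
  have upper: "svm_objective M {1..n} (w_hat, b_hat, \<xi>_hat) \<le>
      agg_svm_objective M K C (w_bar, b_bar, \<xi>_bar)"
    unfolding w_hat b_hat using M_pos
    by (intro hinge_objective_le[OF part _ _ same_label bar_feasible clusters \<xi>_hat]) auto
  have "svm_optimal M {1..n} x y (w_hat, b_hat, \<xi>_hat)"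
    unfolding svm_optimal_def is_arg_min_linorder
    using hat_feasible upper lower by (blast intro: order_trans)
  \<comment> \<open>The disaggregated point is itself feasible, so the lower bound applies to it and
    meets the upper one.\<close>
  moreover have "svm_objective M {1..n} (w_hat, b_hat, \<xi>_hat) = agg_svm_value M K C x y"
    unfolding agg_svm_value_eq[OF bar_optimal]
    using upper lower[OF hat_feasible] by (rule antisym)
  ultimately show ?thesis
    by blast
qed

end
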